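(* The following seven power series are all Apwenian: \begin{align*} F_2(x)&=\Phi(1-x),\\ F_3(x)&=\Phi(1-x-x^2),\\ F_5(x)&=\Phi(1-x-x^2-x^3+x^4),\\ F_{11}(x)&=\Phi(1-x-x^2+x^3-x^4+x^5+x^6+x^7+x^8-x^9-x^{10}),\\ F_{13}(x)&=\Phi(1-x-x^2+x^3-x^4-x^5-x^6-x^7-x^8+x^9-x^{10}-x^{11}+x^{12}),\\ F_{17a}(x)&=\Phi(1-x-x^2+x^3-x^4+x^5+x^6+x^7+x^8+x^9+x^{10}+x^{11}-x^{12}+x^{13}-x^{14}-x^{15}+x^{16}),\\ F_{17b}(x)&=\Phi(1-x-x^2-x^3+x^4+x^5-x^6+x^7+x^8+x^9-x^{10}+x^{11}+x^{12}-x^{13}-x^{14}-x^{15}+x^{16}). \end{align*}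
   Context: For a finite sequence ${\bf v}=(v_0,v_1,\ldots,v_{d-1})$ of length $d\ge 2$ with entries in $\{1,-1\}$ and $v_0=1$, write $\tilde{\bf v}(x)=\sum_{i=0}^{d-1}v_ix^i$ and define the formal power series $$\Phi(\tilde{\bf v}(x))=\prod_{k=0}^\infty \tilde{\bf v}(x^{d^k}),$$ whose coefficients all lie in $\{1,-1\}$. (Here $d=1+\deg \tilde{\bf v}$; so $d=2,3,5,11,13,17,17$ for the seven series respectively.) For a power series $\tilde{\bf c}(x)=\sum_{k\ge0}c_kx^k$ with integer coefficients, the Hankel determinant of order $n\ge 1$ is $H_n(\tilde{\bf c}(x))=\det(c_{i+j})_{0\le i,j\le n-1}$. A power series with all coefficients in $\{1,-1\}$ is called Apwenian if for every positive integer $n$ the number $H_n(\tilde{\bf c}(x))/2^{n-1}$ is an odd integer. *)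

theory Defs
  imports
    "HOL-Computational_Algebra.Polynomial_FPS"
    "HOL-Analysis.Infinite_Products"
    "Jordan_Normal_Form.Determinant"
begin

text \<open>
  The infinite product is a limit in the metric topology on formal power series, i.e. convergence
  of every coefficient. The sequence \<open>v\<close> of length \<open>d\<close> is encoded by its generating polynomial;
  its last entry is nonzero, so \<open>d = Suc (degree v)\<close>. The definition is meaningful only when
  the constant coefficient of \<open>v\<close> is \<open>1\<close> and \<open>d \<ge> 2\<close>: the product then converges, see
  \<open>Phi_has_prod\<close> below.
\<close>

definition Phi :: "int poly \<Rightarrow> int fps" where
  "Phi v = (\<Prod>k. fps_of_poly (v \<circ>\<^sub>p monom 1 (Suc (degree v) ^ k)))"

definition hankel_det :: "'a::comm_ring_1 fps \<Rightarrow> nat \<Rightarrow> 'a" where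
  "hankel_det c n = det (mat n n (\<lambda>(i, j). fps_nth c (i + j)))"

definition apwenian :: "int fps \<Rightarrow> bool" where
  "apwenian c \<longleftrightarrow>
     (\<forall>k. fps_nth c k \<in> {1, -1}) \<and>
     (\<forall>n\<ge>1. \<exists>m::int. odd m \<and> rat_of_int (hankel_det c n) / 2 ^ (n - 1) = rat_of_int m)"

lemma Phi_has_prod:
  assumes "coeff v 0 = 1" and "degree v \<ge> 1"
  shows "(\<lambda>k. fps_of_poly (v \<circ>\<^sub>p monom 1 (Suc (degree v) ^ k))) has_prod Phi v"
proof -
  define d where "d = Suc (degree v)"
  have d: "d \<ge> 2" using assms(2) by (simp add: d_def)
  define f where "f k = fps_of_poly (v \<circ>\<^sub>p monom 1 (d ^ k))" for k
  define P where "P N = (\<Prod>k\<le>N. f k)" for N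
  obtain w where w: "v = 1 + [:0, 1:] * w"
  proof (cases v)
    case (pCons a p)
    with assms(1) have "v = 1 + [:0, 1:] * p"
      by (simp add: poly_eq_iff coeff_pCons split: nat.split)
    then show thesis by (rule that)
  qed
  have f: "f k = 1 + fps_X ^ (d ^ k) * fps_of_poly (w \<circ>\<^sub>p monom 1 (d ^ k))" for k
    unfolding f_def w
    by (simp add: pcompose_add pcompose_mult pcompose_pCons fps_of_poly_add fps_of_poly_mult
          fps_of_poly_monom pcompose_1)
  have step: "fps_nth (P (Suc N)) n = fps_nth (P N) n" if "n \<le> N" for n N
  proof -
    have "n < d ^ Suc N"
      using that d power_gt_expt[of d "Suc N"] by linarith
    moreover have "P (Suc N) = P N + fps_X ^ (d ^ Suc N) * (P N * fps_of_poly (w \<circ>\<^sub>p monom 1 (d ^ Suc N)))"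
      unfolding P_def by (simp add: f algebra_simps)
    ultimately show ?thesis by (simp only: fps_add_nth fps_X_power_mult_nth if_True add_0_right)
  qed
  have stable: "fps_nth (P N) n = fps_nth (P n) n" if "n \<le> N" for n N
    using that by (induction N rule: dec_induct) (auto simp: step)
  define L where "L = Abs_fps (\<lambda>n. fps_nth (P n) n)"
  have lim: "P \<longlonglongrightarrow> L"
  proof (rule tendsto_fpsI)
    fix n show "eventually (\<lambda>N. fps_nth (P N) n = fps_nth L n) sequentially"
      using eventually_ge_at_top[of n] by eventually_elim (unfold L_def fps_nth_Abs_fps, rule stable)
  qed
  have "fps_nth L 0 = 1"
    using assms(1) by (simp add: L_def P_def f_def flip: poly_0_coeff_0) (simp add: poly_pcompose poly_monom)
  hence "L \<noteq> 0" by auto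
  with lim have "f has_prod L"
    by (simp add: has_prod_def raw_has_prod_def P_def[abs_def])
  moreover from this have "f has_prod (\<Prod>k. f k)" by (auto dest: has_prod_unique)
  ultimately show ?thesis
    by (simp add: Phi_def f_def[abs_def] d_def)
qed

end

theory Submission
  imports Defs "HOL-Library.Z2"
begin

text \<open>
  Let \<open>c\<close> be a sequence over \<open>{1, -1}\<close> and write \<open>c (k + 1) = c k + 2 * e k\<close>. Subtracting from each
  row of the Hankel matrix of \<open>c\<close> the row above it produces a factor \<open>2\<close> in every row but the
  first, so \<open>H n / 2 ^ (n - 1)\<close> is the determinant of the matrix with first row
  \<open>c 0, c 1, \<dots>\<close> and the rows \<open>e i, e (i + 1), \<dots>\<close> for \<open>i < n - 1\<close> below it. It is an integer, and
  its parity is a determinant over the field with two elements, in which the first row is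
  constantly \<open>1\<close>.

  This determinant is nonzero for all \<open>n\<close> as soon as \<open>e (2 * n + 1) = 1 + e n\<close> modulo \<open>2\<close>.
  Indeed, over the field with two elements the coefficients of odd index are what a derivative
  sees, and squaring a series spreads its coefficients over the even indices. The recurrence
  therefore is a Riccati equation for the generating function \<open>E\<close> of \<open>e\<close>: the series
  \<open>F = (1 + x) * E\<close> satisfies \<open>((1 + x) * F)' = 1 + F\<^sup>2\<close> (\<open>bit_fps_riccati\<close>). A vector in the kernel
  of the matrix is a polynomial \<open>A \<noteq> 0\<close> for which \<open>A * F\<close> has such a long gap that its initial part
  \<open>B\<close> makes \<open>B / A\<close> an exact rational solution of the same equation. There is none
  (\<open>bit_riccati_no_rational_solution\<close>): evaluating \<open>((1 + x) * A * B)' = A\<^sup>2 + B\<^sup>2\<close> at \<open>1\<close> gives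
  \<open>a * b = a\<^sup>2 + b\<^sup>2\<close>, which over two elements forces \<open>a = b = 0\<close>, so \<open>1 + x\<close> can be cancelled from
  \<open>A\<close> and \<open>B\<close> forever.

  In terms of signs the recurrence for \<open>e\<close> reads \<open>c n * c (n + 1) * c (2 * n + 1) * c (2 * n + 2) = -1\<close>
  (\<open>apwenianI\<close>). The coefficients of \<open>Phi v\<close> satisfy \<open>c (d * k + i) = v i * c k\<close> for \<open>i < d\<close>. With
  \<open>n = d * k + i\<close>, the condition at \<open>n\<close> becomes for \<open>i < d - 1\<close> a condition on the entries of \<open>v\<close>
  alone, while for \<open>i = d - 1\<close> it is the condition at \<open>k\<close>, so that induction applies. What remains
  is a finite check for each of the seven sign sequences.
\<close>

section \<open>Characteristic two\<close>

(* Below, the dollar sign denotes entries of vectors, not coefficients of power series. *)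
unbundle no fps_syntax

text \<open>
  By default the simplifier turns the field operations on \<open>bit\<close> into bitwise ones, which defeats
  ring normalisation.
\<close>

declare add_bit_eq_xor [simp del] mult_bit_eq_and [simp del] power_bit_unfold [simp del]

lemma bit_add_self [simp]: "(a :: bit) + a = 0"
  by (cases a) auto

lemma bit_add_self_left [simp]: "(a :: bit) + (a + b) = b"
  by (simp flip: add.assoc)

lemma bit_mult_self [simp]: "(a :: bit) * a = a"
  by (cases a) auto

lemma of_nat_bit: "(of_nat n :: bit) = of_bool (odd n)"
  by (induction n) auto

lemma bit_poly_add_self [simp]: "(p :: bit poly) + p = 0"
  by (rule poly_eqI) (simp only: coeff_add coeff_0 bit_add_self)

lemma bit_poly_2_eq_0 [simp]: "(2 :: bit poly) = 0"
  by (simp only: bit_poly_add_self flip: one_add_one)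

lemma bit_fps_add_self [simp]: "(f :: bit fps) + f = 0"
  by (rule fps_ext) (simp only: fps_add_nth fps_zero_nth bit_add_self)

lemma bit_fps_2_eq_0 [simp]: "(2 :: bit fps) = 0"
  by (simp only: bit_fps_add_self flip: one_add_one)

lemma pderiv_bit_square [simp]: "pderiv ((p :: bit poly)\<^sup>2) = 0"
  by (simp add: power2_eq_square pderiv_mult mult.commute)

lemma fps_deriv_bit_square [simp]: "fps_deriv ((f :: bit fps)\<^sup>2) = 0"
  by (simp add: power2_eq_square mult.commute)

text \<open>
  This is the Frobenius endomorphism. It follows by peeling off the constant term: in
  \<open>f = x * g + c\<close> the mixed term of \<open>f\<^sup>2\<close> occurs twice and vanishes.
\<close>

lemma bit_fps_nth_square:
  fixes f :: "bit fps"
  shows "fps_nth (f\<^sup>2) n = (if even n then fps_nth f (n div 2) else 0)"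
proof (induction n arbitrary: f rule: less_induct)
  case (less n)
  define c g where "c = fps_const (fps_nth f 0)" and "g = fps_shift 1 f"
  have f: "f = fps_X * g + c"
    unfolding c_def g_def by (rule fps_ext) (auto simp: fps_X_mult_nth)
  have "f\<^sup>2 = fps_X ^ 2 * g\<^sup>2 + (fps_X * g * c + fps_X * g * c) + c * c"
    unfolding f by (simp add: power2_eq_square algebra_simps del: bit_fps_add_self)
  also have "c * c = c"
    unfolding c_def by simp
  finally have f2: "f\<^sup>2 = fps_X ^ 2 * g\<^sup>2 + c"
    by simp
  show ?case
  proof (cases "n < 2")
    case True
    then have "n = 0 \<or> n = 1" by auto
    then show ?thesis unfolding f2 by (auto simp: fps_X_power_mult_nth c_def)
  next
    case False
    have Suc_half: "Suc ((n - 2) div 2) = n div 2"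
      using False by presburger
    have "fps_nth (f\<^sup>2) n = fps_nth (g\<^sup>2) (n - 2)"
      using False unfolding f2 by (simp add: fps_X_power_mult_nth c_def)
    also have "\<dots> = (if even (n - 2) then fps_nth g ((n - 2) div 2) else 0)"
      using False by (intro less.IH) auto
    also have "(if even (n - 2) then fps_nth g ((n - 2) div 2) else 0)
        = (if even n then fps_nth f (n div 2) else 0)"
      using False Suc_half by (simp add: g_def)
    finally show ?thesis .
  qed
qed

section \<open>A Riccati equation over the field with two elements\<close>

text \<open>
  The equation is homogeneous in \<open>(A, B)\<close>: it states that \<open>F = B / A\<close> satisfies
  \<open>((1 + x) * F)' = 1 + F\<^sup>2\<close>, because \<open>A\<^sup>2\<close> is a constant for the derivation. Its value at \<open>1\<close> shows that
  \<open>1 + x\<close> divides both \<open>A\<close> and \<open>B\<close>, and homogeneity allows the factor to be cancelled, so the proof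
  is by infinite descent on the degree of \<open>A\<close>.
\<close>

lemma bit_riccati_no_rational_solution:
  fixes A B :: "bit poly"
  assumes "pderiv ([:1, 1:] * (A * B)) = A\<^sup>2 + B\<^sup>2"
  shows "A = 0"
  using assms
proof (induction "degree A" arbitrary: A B rule: less_induct)
  case less
  show ?case
  proof (rule ccontr)
    assume "A \<noteq> 0"
    define q :: "bit poly" where "q = [:1, 1:]"
    have "poly (pderiv (q * (A * B))) 1 = poly A 1 * poly B 1"
      unfolding q_def pderiv_mult by (simp add: pderiv_pCons)
    then have "poly A 1 * poly B 1 = (poly A 1)\<^sup>2 + (poly B 1)\<^sup>2"
      using less.prems by (simp add: q_def)
    then have "poly A 1 = 0" "poly B 1 = 0"
      by (cases "poly A 1"; cases "poly B 1"; simp)+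
    then have "q dvd A" "q dvd B"
      using poly_eq_0_iff_dvd[of _ "1 :: bit"] by (auto simp: q_def)
    then obtain A' B' where A: "A = q * A'" and B: "B = q * B'"
      by (auto elim!: dvdE)
    have "q\<^sup>2 * (A'\<^sup>2 + B'\<^sup>2) = A\<^sup>2 + B\<^sup>2"
      unfolding A B by (simp add: power2_eq_square algebra_simps)
    also have "\<dots> = pderiv (q\<^sup>2 * (q * (A' * B')))"
      using less.prems unfolding q_def[symmetric] A B by (simp add: power2_eq_square ac_simps)
    also have "\<dots> = q\<^sup>2 * pderiv (q * (A' * B'))"
      by (subst pderiv_mult) simp
    finally have eq: "pderiv (q * (A' * B')) = A'\<^sup>2 + B'\<^sup>2"
      by (simp add: q_def)
    have "A' \<noteq> 0"
      using \<open>A \<noteq> 0\<close> unfolding A by auto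
    then have "degree A' < degree A"
      unfolding A by (subst degree_mult_eq) (auto simp: q_def)
    then show False
      using less.hyps[of A' B'] eq \<open>A' \<noteq> 0\<close> by (simp add: q_def)
  qed
qed

text \<open>
  With \<open>E\<close> the generating function of \<open>e\<close>, the hypothesis compares the coefficient of
  \<open>x ^ (2 * n)\<close> in \<open>E'\<close> with that in \<open>E\<^sup>2\<close>: the recurrence is
  \<open>E' = 1 / (1 + x\<^sup>2) + E\<^sup>2\<close>. The factor \<open>(1 + x)\<^sup>2 = 1 + x\<^sup>2\<close> clears the denominator and has
  derivative \<open>0\<close>.
\<close>

lemma bit_fps_riccati:
  fixes e :: "nat \<Rightarrow> bit"
  assumes e: "\<And>n. e (2 * n + 1) = 1 + e n"
  defines "F \<equiv> (1 + fps_X) * Abs_fps e"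
  shows "fps_deriv ((1 + fps_X) * F) = 1 + F\<^sup>2"
proof -
  define E where "E = Abs_fps e"
  have sq: "(1 + fps_X :: bit fps)\<^sup>2 = 1 + fps_X\<^sup>2"
    by (simp add: power2_sum)
  have "(1 + fps_X\<^sup>2) * fps_deriv E = 1 + (1 + fps_X\<^sup>2) * E\<^sup>2"
  proof (rule fps_ext)
    fix n :: nat
    have D: "fps_nth (fps_deriv E) n = of_bool (even n) + fps_nth (E\<^sup>2) n" for n
      using e[of "n div 2"]
      by (cases "even n") (auto simp: bit_fps_nth_square E_def of_nat_bit simp del: of_nat_Suc)
    show "fps_nth ((1 + fps_X\<^sup>2) * fps_deriv E) n = fps_nth (1 + (1 + fps_X\<^sup>2) * E\<^sup>2) n"
      by (cases "n < 2")
         (auto simp: distrib_right fps_X_power_mult_nth D less_2_cases_iff add_ac simp del: fps_deriv_nth)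
  qed
  then show ?thesis
    unfolding F_def E_def[symmetric]
    by (simp add: power_mult_distrib sq fps_deriv_mult flip: mult.assoc power2_eq_square)
qed

text \<open>
  A kernel vector \<open>v\<close>, read backwards, is a polynomial \<open>A0\<close> of degree at most \<open>m\<close>. The first row
  gives \<open>A0 = (1 + x) * A\<close>. The other \<open>m\<close> rows state that \<open>G = A0 * E = A * F\<close> has no terms in degrees
  \<open>m, \<dots>, 2 * m - 1\<close>, so \<open>G\<close> agrees up to order \<open>2 * m\<close> with a polynomial \<open>B\<close> of degree less than
  \<open>m\<close>. In the Riccati equation for \<open>F\<close>, multiplied by \<open>A\<^sup>2\<close>, replacing \<open>G\<close> by \<open>B\<close> changes only terms
  of degree at least \<open>2 * m - 1\<close>, whereas the resulting polynomials have degree at most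
  \<open>2 * m - 2\<close>. Hence \<open>B / A\<close> solves the equation exactly, which is impossible.
\<close>

lemma bit_det_nonzero:
  fixes e :: "nat \<Rightarrow> bit"
  assumes e: "\<And>n. e (2 * n + 1) = 1 + e n"
  shows "det (mat (Suc m) (Suc m) (\<lambda>(i, j). if i = 0 then 1 else e (i - 1 + j))) \<noteq> 0"
    (is "det ?M \<noteq> 0")
proof
  assume "det ?M = 0"
  then obtain v where v: "v \<in> carrier_vec (Suc m)" "v \<noteq> 0\<^sub>v (Suc m)" "?M *\<^sub>v v = 0\<^sub>v (Suc m)"
    using det_0_iff_vec_prod_zero_field[of ?M "Suc m"] by auto
  have ker: "(\<Sum>j<Suc m. (if i = 0 then 1 else e (i - 1 + j)) * v $ j) = 0" if "i \<le> m" for i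
  proof -
    have "(?M *\<^sub>v v) $ i = 0" using v that by simp
    then show ?thesis
      using v(1) that by (simp add: scalar_prod_def lessThan_atLeast0 del: sum.op_ivl_Suc)
  qed
  define q :: "bit poly" where "q = [:1, 1:]"
  define A0 where "A0 = (\<Sum>j<Suc m. monom (v $ j) (m - j))"
  have coeff_A0: "coeff A0 (m - j) = v $ j" if "j \<le> m" for j
  proof -
    have "coeff A0 (m - j) = (\<Sum>i<Suc m. if i = j then v $ j else 0)"
      unfolding A0_def coeff_sum coeff_monom using that by (intro sum.cong) auto
    then show ?thesis using that by (simp del: sum.lessThan_Suc)
  qed
  have "A0 \<noteq> 0"
  proof
    assume "A0 = 0"
    then have "v $ j = 0" if "j \<le> m" for j using coeff_A0[OF that] by simp
    then have "v = 0\<^sub>v (Suc m)" using v(1) by (intro eq_vecI) auto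
    then show False using v(2) by simp
  qed
  have "degree A0 \<le> m"
    unfolding A0_def by (intro degree_sum_le order.trans[OF degree_monom_le]) auto
  have "poly A0 1 = 0"
    using ker[of 0] by (simp add: A0_def poly_sum poly_monom del: sum.lessThan_Suc)
  then have "q dvd A0"
    using poly_eq_0_iff_dvd[of A0 1] by (simp add: q_def)
  then obtain A where A: "A0 = q * A" by (auto elim!: dvdE)
  have "A \<noteq> 0"
    using \<open>A0 \<noteq> 0\<close> unfolding A by auto
  then have "degree A0 = Suc (degree A)"
    unfolding A by (subst degree_mult_eq) (auto simp: q_def)
  with \<open>degree A0 \<le> m\<close> have "degree A < m"
    by simp
  define E where "E = Abs_fps e"
  define F where "F = (1 + fps_X) * E"
  define G where "G = fps_of_poly A0 * E"
  have q: "fps_of_poly q = 1 + fps_X"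
    unfolding q_def by (simp add: fps_of_poly_pCons)
  have G: "G = fps_of_poly A * F"
    unfolding G_def F_def A by (simp add: fps_of_poly_mult q ac_simps)
  have G0: "fps_nth G (m + i) = 0" if "i < m" for i
  proof -
    have "fps_nth G (m + i) = (\<Sum>j<Suc m. v $ j * fps_nth (fps_X ^ (m - j) * E) (m + i))"
      unfolding G_def A0_def
      by (simp add: fps_of_poly_sum sum_distrib_right fps_sum_nth fps_of_poly_monom mult.assoc
               del: sum.lessThan_Suc)
    also have "\<dots> = (\<Sum>j<Suc m. (if Suc i = 0 then 1 else e (Suc i - 1 + j)) * v $ j)"
    proof (intro sum.cong refl)
      fix j assume "j \<in> {..<Suc m}"
      then have "fps_nth (fps_X ^ (m - j) * E) (m + i) = e (i + j)"
        by (auto simp: fps_X_power_mult_nth E_def intro!: arg_cong[of _ _ e])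
      then show "v $ j * fps_nth (fps_X ^ (m - j) * E) (m + i)
          = (if Suc i = 0 then 1 else e (Suc i - 1 + j)) * v $ j"
        by simp
    qed
    also have "\<dots> = 0"
      using ker[of "Suc i"] that by simp
    finally show ?thesis .
  qed
  define B where "B = truncate_fps m G"
  have "degree B < m"
    unfolding B_def using \<open>degree A < m\<close> by (intro degree_truncate_fps) auto
  define R where "R = fps_shift (2 * m) G"
  have GB: "G = fps_of_poly B + fps_X ^ (2 * m) * R"
  proof (rule fps_ext)
    fix k
    show "fps_nth G k = fps_nth (fps_of_poly B + fps_X ^ (2 * m) * R) k"
      using G0[of "k - m"]
      by (auto simp: B_def R_def fps_X_power_mult_nth coeff_truncate_fps)
  qed
  have riccati: "fps_deriv ((1 + fps_X) * fps_of_poly A * G) = (fps_of_poly A)\<^sup>2 + G\<^sup>2"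
  proof -
    have "fps_deriv ((1 + fps_X) * fps_of_poly A * G) = fps_deriv ((fps_of_poly A)\<^sup>2 * ((1 + fps_X) * F))"
      unfolding G by (simp add: power2_eq_square ac_simps del: fps_deriv_mult)
    also have "\<dots> = (fps_of_poly A)\<^sup>2 * fps_deriv ((1 + fps_X) * F)"
      by (subst fps_deriv_mult) simp
    also have "fps_deriv ((1 + fps_X) * F) = 1 + F\<^sup>2"
      unfolding F_def E_def by (rule bit_fps_riccati) (rule e)
    also have "(fps_of_poly A)\<^sup>2 * (1 + F\<^sup>2) = (fps_of_poly A)\<^sup>2 + G\<^sup>2"
      unfolding G by (simp add: power_mult_distrib distrib_left)
    finally show ?thesis .
  qed
  have "pderiv (q * (A * B)) = A\<^sup>2 + B\<^sup>2"
  proof (rule poly_eqI)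
    fix k
    show "coeff (pderiv (q * (A * B))) k = coeff (A\<^sup>2 + B\<^sup>2) k"
    \<comment> \<open>One below \<open>2 * m\<close>, since differentiating the error term \<open>x ^ (2 * m) * T\<close> costs one order.\<close>
    proof (cases "k < 2 * m - 1")
      case True
      define T where "T = (1 + fps_X) * fps_of_poly A * R"
      have "(1 + fps_X) * fps_of_poly A * G = fps_of_poly (q * (A * B)) + fps_X ^ (2 * m) * T"
        unfolding GB T_def by (simp add: fps_of_poly_mult q algebra_simps)
      then have "fps_of_poly (pderiv (q * (A * B))) + fps_deriv (fps_X ^ (2 * m) * T)
          = fps_of_poly (A\<^sup>2) + G\<^sup>2"
        using riccati by (simp add: fps_of_poly_pderiv fps_of_poly_power del: fps_deriv_mult)
      then have "coeff (pderiv (q * (A * B))) k + fps_nth (fps_deriv (fps_X ^ (2 * m) * T)) k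
          = coeff (A\<^sup>2) k + fps_nth (G\<^sup>2) k"
        by (metis fps_add_nth fps_of_poly_nth)
      moreover have "fps_nth (fps_deriv (fps_X ^ (2 * m) * T)) k = 0"
        using True by (simp add: fps_X_power_mult_nth del: fps_deriv_mult)
      moreover have "fps_nth (G\<^sup>2) k = coeff (B\<^sup>2) k"
      proof -
        have "k div 2 < 2 * m" using True by linarith
        then have "fps_nth (G\<^sup>2) k = fps_nth ((fps_of_poly B)\<^sup>2) k"
          unfolding bit_fps_nth_square GB by (simp add: fps_X_power_mult_nth)
        then show ?thesis by (simp flip: fps_of_poly_power)
      qed
      ultimately show ?thesis by simp
    next
      case False
      have "coeff (q * (A * B)) (Suc k) = 0"
      proof (rule coeff_eq_0)
        have "degree (q * (A * B)) \<le> 1 + (degree A + degree B)"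
          using degree_mult_le[of q "A * B"] degree_mult_le[of A B] by (simp add: q_def)
        then show "degree (q * (A * B)) < Suc k"
          using False \<open>degree A < m\<close> \<open>degree B < m\<close> by linarith
      qed
      moreover have "coeff (P\<^sup>2) k = 0" if "degree P < m" for P :: "bit poly"
        using False that degree_power_le[of P 2] by (intro coeff_eq_0) linarith
      ultimately show ?thesis
        using \<open>degree A < m\<close> \<open>degree B < m\<close> by (simp add: coeff_pderiv)
    qed
  qed
  then have "A = 0"
    unfolding q_def by (rule bit_riccati_no_rational_solution)
  then show False using \<open>A \<noteq> 0\<close> by simp
qed

section \<open>The coefficients of the infinite product\<close>

text \<open>
  The exponents of \<open>p(x ^ d)\<close> are multiples of \<open>d\<close> and those of \<open>v\<close> are smaller than \<open>d\<close>, so every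
  exponent of the product arises in a single way, by division with remainder.
\<close>

lemma coeff_mult_pcompose_monom:
  fixes v p :: "'a::comm_semiring_1 poly"
  assumes "degree v < d" "i < d"
  shows "coeff (v * (p \<circ>\<^sub>p monom 1 d)) (d * k + i) = coeff v i * coeff p k"
proof (induction p arbitrary: k)
  case 0
  then show ?case by simp
next
  case (pCons a p)
  have split: "v * (pCons a p \<circ>\<^sub>p monom 1 d) = Polynomial.smult a v + monom 1 d * (v * (p \<circ>\<^sub>p monom 1 d))"
    by (simp add: pcompose_pCons algebra_simps)
  show ?case
  proof (cases k)
    case 0
    then show ?thesis
      using assms unfolding split by (simp add: coeff_monom_mult mult.commute)
  next
    case (Suc k')
    have "coeff v (d * k + i) = 0"
      using assms Suc by (intro coeff_eq_0) auto
    moreover have "d * k + i - d = d * k' + i"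
      using Suc by simp
    ultimately show ?thesis
      using pCons.IH[of k'] Suc unfolding split by (simp add: coeff_monom_mult)
  qed
qed

lemma monom_1_pcompose: "monom 1 n \<circ>\<^sub>p q = q ^ n"
  by (induction n) (simp_all add: monom_Suc pcompose_pCons pcompose_1)

text \<open>
  The second equation is the functional equation \<open>Phi v = v(x) * Phi v(x ^ d)\<close>, read off
  coefficientwise. It holds for the partial products, where it shifts their index by one, and
  each coefficient of the partial products is eventually constant.
\<close>

lemma Phi_nth:
  assumes "coeff v 0 = 1" "degree v \<ge> 1" "d = Suc (degree v)"
  shows Phi_nth_0: "fps_nth (Phi v) 0 = 1"
    and Phi_nth_digit: "i < d \<Longrightarrow> fps_nth (Phi v) (d * k + i) = coeff v i * fps_nth (Phi v) k"
proof -
  define P where "P N = (\<Prod>k<N. v \<circ>\<^sub>p monom 1 (d ^ k))" for N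
  have "(\<lambda>N. fps_of_poly (P N)) \<longlonglongrightarrow> Phi v"
    using has_prod_imp_tendsto'[OF Phi_has_prod[OF assms(1,2)]]
    by (simp add: P_def assms(3) fps_of_poly_prod)
  then have lim: "eventually (\<lambda>N. coeff (P N) n = fps_nth (Phi v) n) sequentially" for n
    unfolding tendsto_fps_iff by simp
  have P_Suc: "P (Suc N) = v * (P N \<circ>\<^sub>p monom 1 d)" for N
  proof -
    have "P (Suc N) = (v \<circ>\<^sub>p monom 1 1) * (\<Prod>k<N. v \<circ>\<^sub>p monom 1 (d ^ Suc k))"
      unfolding P_def prod.lessThan_Suc_shift by simp
    moreover have "monom 1 (d ^ Suc k) = monom 1 (d ^ k) \<circ>\<^sub>p monom (1::int) d" for k
      by (simp add: monom_1_pcompose monom_power mult.commute)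
    ultimately show ?thesis
      by (simp add: P_def pcompose_prod pcompose_assoc monom_altdef)
  qed
  have "coeff (P N) 0 = 1" for N
    using assms(1) unfolding P_def
    by (simp add: poly_prod poly_pcompose poly_monom assms(3) power_0_left flip: poly_0_coeff_0)
  then show "fps_nth (Phi v) 0 = 1"
    using lim[of 0] by (simp add: eventually_const)
  assume "i < d"
  have "eventually (\<lambda>N. coeff (P (Suc N)) (d * k + i) = fps_nth (Phi v) (d * k + i)) sequentially"
    using lim[of "d * k + i"] by (subst eventually_sequentially_Suc)
  with lim[of k] have "eventually (\<lambda>N::nat. fps_nth (Phi v) (d * k + i) = coeff v i * fps_nth (Phi v) k) sequentially"
  proof eventually_elim
    case (elim N)
    then show ?case
      using coeff_mult_pcompose_monom[of v d i "P N" k] \<open>i < d\<close> assms(3) by (simp add: P_Suc)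
  qed
  then show "fps_nth (Phi v) (d * k + i) = coeff v i * fps_nth (Phi v) k"
    by (simp add: eventually_const)
qed

lemma Phi_nth_unit:
  assumes "degree v \<ge> 1" "coeff v 0 = 1" "\<And>i. i \<le> degree v \<Longrightarrow> coeff v i \<in> {1, -1}"
  shows "fps_nth (Phi v) n \<in> {1, -1}"
proof (induction n rule: less_induct)
  case (less n)
  define d where "d = Suc (degree v)"
  show ?case
  proof (cases "n = 0")
    case True
    then show ?thesis using Phi_nth_0[OF assms(2,1)] by simp
  next
    case False
    then have "n div d < n" "n mod d < d" using assms(1) by (auto simp: d_def)
    moreover have "fps_nth (Phi v) n = coeff v (n mod d) * fps_nth (Phi v) (n div d)"
      using Phi_nth_digit[OF assms(2,1) d_def, of "n mod d" "n div d"] \<open>n mod d < d\<close> by simp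
    ultimately show ?thesis
      using less[of "n div d"] assms(3)[of "n mod d"] by (auto simp: d_def)
  qed
qed

section \<open>Criteria for Apwenian series\<close>

text \<open>
  The row operations are recorded as a factorisation \<open>L * M\<close> of the Hankel matrix with \<open>L\<close> lower
  triangular: by telescoping, row \<open>i\<close> is the first row plus twice the sum of the first \<open>i\<close>
  rows of differences. So \<open>det L = 2 ^ m\<close> is exactly the required power of two. The sign
  condition is the recurrence of \<open>bit_det_nonzero\<close>: modulo \<open>2\<close>, the half-difference \<open>e k\<close> is \<open>1\<close> if
  and only if \<open>c k * c (k + 1) = -1\<close>.
\<close>

lemma apwenianI:
  fixes c :: "int fps"
  assumes unit: "\<And>k. fps_nth c k \<in> {1, -1}"
  assumes crit: "\<And>n. fps_nth c n * fps_nth c (n + 1) * fps_nth c (2 * n + 1) * fps_nth c (2 * n + 2) = -1"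
  shows "apwenian c"
  unfolding apwenian_def
proof (intro conjI allI impI unit)
  fix n :: nat
  assume "n \<ge> 1"
  then obtain m where n: "n = Suc m" by (cases n) auto
  define e where "e k = (fps_nth c (Suc k) - fps_nth c k) div 2" for k
  have e: "fps_nth c (Suc k) = fps_nth c k + 2 * e k" for k
    using unit[of k] unit[of "Suc k"] by (auto simp: e_def)
  define L where "L = mat n n (\<lambda>(i, j). if j = 0 then 1 else if j \<le> i then 2 else 0 :: int)"
  define M where "M = mat n n (\<lambda>(i, j). if i = 0 then fps_nth c j else e (i - 1 + j))"
  have [simp]: "L \<in> carrier_mat n n" "M \<in> carrier_mat n n"
    by (auto simp: L_def M_def)
  have sum_e: "fps_nth c (i + j) = fps_nth c j + (\<Sum>t<i. 2 * e (t + j))" for i j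
    by (induction i) (simp_all add: e)
  have "mat n n (\<lambda>(i, j). fps_nth c (i + j)) = L * M"
  proof (rule eq_matI)
    fix i j assume "i < dim_row (L * M)" "j < dim_col (L * M)"
    then have ij: "i \<le> m" "j < n" by (auto simp: L_def M_def n)
    then have "(L * M) $$ (i, j) = (\<Sum>t<Suc m. L $$ (i, t) * M $$ (t, j))"
      by (simp add: L_def M_def scalar_prod_def n lessThan_atLeast0 del: sum.op_ivl_Suc)
    also have "\<dots> = fps_nth c j + (\<Sum>t<m. if t < i then 2 * e (t + j) else 0)"
      unfolding sum.lessThan_Suc_shift using ij by (auto simp: L_def M_def n intro!: sum.cong)
    also have "(\<Sum>t<m. if t < i then 2 * e (t + j) else 0) = (\<Sum>t<i. 2 * e (t + j))"
      using ij by (intro sum.mono_neutral_cong_right) auto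
    finally show "mat n n (\<lambda>(i, j). fps_nth c (i + j)) $$ (i, j) = (L * M) $$ (i, j)"
      using ij by (simp add: sum_e n)
  qed (auto simp: L_def M_def)
  moreover have "det L = 2 ^ m"
  proof -
    have "det L = (\<Prod>i = 0..<n. L $$ (i, i))"
      by (subst det_lower_triangular[of n]) (auto simp: L_def prod_list_diag_prod)
    also have "\<dots> = 2 ^ m"
      unfolding n prod.atLeast0_lessThan_Suc_shift by (simp add: L_def n)
    finally show ?thesis .
  qed
  ultimately have H: "hankel_det c n = 2 ^ m * det M"
    unfolding hankel_det_def by (simp add: det_mult[of L n M])
  have "(of_int (det M) :: bit) = det (map_mat of_int M)"
    by simp
  also have "map_mat of_int M = mat n n (\<lambda>(i, j). if i = 0 then 1 else of_int (e (i - 1 + j)) :: bit)"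
  proof (rule eq_matI)
    show "map_mat of_int M $$ (i, j) = mat n n (\<lambda>(i, j). if i = 0 then 1 else of_int (e (i - 1 + j)) :: bit) $$ (i, j)"
      if "i < dim_row (mat n n (\<lambda>(i, j). if i = 0 then 1 else of_int (e (i - 1 + j)) :: bit))"
         "j < dim_col (mat n n (\<lambda>(i, j). if i = 0 then 1 else of_int (e (i - 1 + j)) :: bit))" for i j
      using that unit[of j] by (auto simp: M_def)
  qed (auto simp: M_def)
  also have "det \<dots> \<noteq> 0"
    unfolding n
  proof (rule bit_det_nonzero)
    fix k
    show "(of_int (e (2 * k + 1)) :: bit) = 1 + of_int (e k)"
      using crit[of k] unit[of k] unit[of "k + 1"] unit[of "2 * k + 1"] unit[of "2 * k + 2"]
      by (auto simp: e_def)
  qed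
  finally have "odd (det M)"
    by (auto elim!: evenE)
  then show "\<exists>k. odd k \<and> rat_of_int (hankel_det c n) / 2 ^ (n - 1) = rat_of_int k"
    by (intro exI[of _ "det M"]) (simp add: H[unfolded n] n)
qed

text \<open>
  The condition of \<open>apwenianI\<close> has to be assumed only for \<open>n = d * k + i\<close> with \<open>i < d - 1\<close>. For
  \<open>i = d - 1\<close> both \<open>n + 1 = d * (k + 1)\<close> and \<open>2 * n + 2 = d * (2 * k + 2)\<close> are carries, the two
  factors \<open>v (d - 1)\<close> cancel, and the condition is inherited from \<open>k\<close>, which is smaller than
  \<open>n\<close>.
\<close>

lemma apwenian_PhiI:
  assumes deg: "degree v \<ge> 1" and d: "d = Suc (degree v)"
  assumes v0: "coeff v 0 = 1" and v: "\<And>i. i \<le> degree v \<Longrightarrow> coeff v i \<in> {1, -1}"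
  assumes crit: "\<And>k i. i < degree v \<Longrightarrow> coeff v i * coeff v (i + 1) *
    fps_nth (Phi v) (2 * (d * k + i) + 1) * fps_nth (Phi v) (2 * (d * k + i) + 2) = -1"
  shows "apwenian (Phi v)"
proof (rule apwenianI)
  define c where "c = fps_nth (Phi v)"
  note digit = Phi_nth_digit[OF v0 deg d, folded c_def]
  show unit: "fps_nth (Phi v) n \<in> {1, -1}" for n
    by (rule Phi_nth_unit[OF deg v0 v])
  have sq: "c n * c n = 1" for n
    using unit[of n] unfolding c_def by auto
  have "c n * c (n + 1) * c (2 * n + 1) * c (2 * n + 2) = -1" for n
  proof (induction n rule: less_induct)
    case (less n)
    define k i where "k = n div d" and "i = n mod d"
    have n: "n = d * k + i"
      by (simp add: k_def i_def)
    have i: "i < d"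
      using d by (simp add: i_def)
    show ?case
    proof (cases "i = degree v")
      case False
      then have i1: "i < degree v" using i d by simp
      have "c n * c (n + 1) = coeff v i * coeff v (i + 1) * (c k * c k)"
        using digit[of i k] digit[of "i + 1" k] i1 d by (simp add: n)
      then show ?thesis
        using crit[OF i1, of k] unfolding n by (simp add: sq flip: c_def)
    next
      case True
      have "k < n"
        using d deg True unfolding n by (cases k) auto
      have v1: "coeff v i * coeff v i = 1" using v[of i] True by auto
      have digit0: "c (d * x) = c x" for x
        using digit[of 0 x] v0 d by simp
      have carry: "n + 1 = d * (k + 1)" "2 * n + 1 = d * (2 * k + 1) + i" "2 * n + 2 = d * (2 * k + 2)"
        using True d by (auto simp: n algebra_simps)
      have "c n = coeff v i * c k"
        unfolding n by (rule digit[OF i])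
      moreover have "c (n + 1) = c (k + 1)"
        unfolding carry by (rule digit0)
      moreover have "c (2 * n + 1) = coeff v i * c (2 * k + 1)"
        unfolding carry by (rule digit[OF i])
      moreover have "c (2 * n + 2) = c (2 * k + 2)"
        unfolding carry by (rule digit0)
      ultimately have "c n * c (n + 1) * c (2 * n + 1) * c (2 * n + 2)
        = (coeff v i * coeff v i) * (c k * c (k + 1) * c (2 * k + 1) * c (2 * k + 2))"
        by (simp only: ac_simps)
      then show ?thesis using less[OF \<open>k < n\<close>] v1 by simp
    qed
  qed
  then show "fps_nth (Phi v) n * fps_nth (Phi v) (n + 1) *
      fps_nth (Phi v) (2 * n + 1) * fps_nth (Phi v) (2 * n + 2) = -1" for n
    by (simp only: c_def)
qed

text \<open>
  For odd \<open>d\<close> and \<open>i < d - 1\<close>, the indices \<open>2 * i + 1\<close> and \<open>2 * i + 2\<close> have the same quotient \<open>s\<close> by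
  \<open>d\<close>: otherwise \<open>d\<close> would divide \<open>2 * (i + 1)\<close> and hence \<open>i + 1\<close>. So \<open>c (2 * n + 1)\<close> and
  \<open>c (2 * n + 2)\<close> share the factor \<open>c (2 * k + s)\<close>, which cancels, and the condition depends only on
  \<open>v\<close>.
\<close>

lemma apwenian_Phi_oddI:
  assumes d: "d = Suc (degree v)" "odd d" "d \<ge> 2"
  assumes v0: "coeff v 0 = 1" and v: "\<And>i. i < d \<Longrightarrow> coeff v i \<in> {1, -1}"
  assumes crit: "\<And>i. i < d - 1 \<Longrightarrow>
    coeff v i * coeff v (i + 1) * coeff v ((2 * i + 1) mod d) * coeff v ((2 * i + 2) mod d) = -1"
  shows "apwenian (Phi v)"
proof -
  have deg: "degree v \<ge> 1" using d by simp
  note digit = Phi_nth_digit[OF v0 deg d(1)]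
  show ?thesis
  proof (rule apwenian_PhiI[OF deg d(1) v0])
    fix k i assume i: "i < degree v"
    define s where "s = (2 * i + 1) div d"
    define r where "r = (2 * i + 1) mod d"
    have r: "2 * i + 1 = d * s + r" "r < d"
      using d(3) by (auto simp: s_def r_def)
    have "r + 1 \<noteq> d"
    proof
      assume "r + 1 = d"
      with r have "2 * (i + 1) = d * (s + 1)" by simp
      then have "d dvd 2 * (i + 1)" by simp
      then have "d dvd i + 1"
        using d(2) coprime_dvd_mult_right_iff[of d 2 "i + 1"] by simp
      then show False using i d(1) by (auto dest!: dvd_imp_le)
    qed
    then have r1: "r + 1 < d" using r by simp
    have "2 * i + 2 = d * s + (r + 1)" using r by simp
    then have "(2 * i + 2) mod d = (r + 1) mod d" by (simp only: mod_mult_self4)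
    then have mod: "(2 * i + 1) mod d = r" "(2 * i + 2) mod d = r + 1"
      using r1 by (simp_all add: r_def)
    have idx: "2 * (d * k + i) + 1 = d * (2 * k + s) + r" "2 * (d * k + i) + 2 = d * (2 * k + s) + (r + 1)"
      using r by (simp_all add: algebra_simps)
    have "fps_nth (Phi v) (2 * k + s) \<in> {1, -1}"
      using v d(1) by (intro Phi_nth_unit[OF deg v0]) auto
    then have sq: "fps_nth (Phi v) (2 * k + s) * fps_nth (Phi v) (2 * k + s) = 1"
      by auto
    have "fps_nth (Phi v) (2 * (d * k + i) + 1) * fps_nth (Phi v) (2 * (d * k + i) + 2)
        = coeff v r * coeff v (r + 1) * (fps_nth (Phi v) (2 * k + s) * fps_nth (Phi v) (2 * k + s))"
      unfolding idx digit[OF r(2)] digit[OF r1] by (simp only: ac_simps)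
    moreover have "coeff v i * coeff v (i + 1) * (coeff v r * coeff v (r + 1)) = -1"
      using crit[of i] i d(1) unfolding mod by (simp add: mult.assoc)
    ultimately show "coeff v i * coeff v (i + 1) * fps_nth (Phi v) (2 * (d * k + i) + 1) *
       fps_nth (Phi v) (2 * (d * k + i) + 2) = -1"
      by (simp add: sq mult.assoc)
  qed (use v d in auto)
qed

text \<open>
  For the even length \<open>d = 2\<close> the indices \<open>2 * n + 1\<close> and \<open>2 * n + 2\<close> with \<open>n = 2 * k\<close> do not have
  the same quotient by \<open>d\<close>. Instead \<open>c (4 * k + 1) = - c (2 * k) = - c k\<close> and
  \<open>c (4 * k + 2) = c (2 * k + 1) = - c k\<close>, so their product is \<open>1\<close>, while \<open>c n * c (n + 1) = -1\<close>.
\<close>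

lemma apwenian_Phi_Thue_Morse: "apwenian (Phi [:1, -1:])"
proof (rule apwenian_PhiI[where d = 2])
  define c where "c = fps_nth (Phi [:1, -1:])"
  have digit: "c (2 * k + i) = coeff [:1, -1:] i * c k" if "i < 2" for k i
    using that Phi_nth_digit[of "[:1, -1:]" 2 i k] by (simp add: c_def)
  fix k i assume "i < degree [:1, -1 :: int:]"
  then have "i = 0" by simp
  have "c k \<in> {1, -1}"
    unfolding c_def by (rule Phi_nth_unit) (auto simp: coeff_pCons split: nat.splits)
  then have "c k * c k = 1" by auto
  moreover have "c (2 * (2 * k) + 1) = - c (2 * k)" "c (2 * (2 * k) + 2) = - c k"
    using digit[of 1 "2 * k"] digit[of 0 "2 * k + 1"] digit[of 1 k] by (simp_all add: algebra_simps)
  moreover have "c (2 * k) = c k" using digit[of 0 k] by simp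
  ultimately show "coeff [:1, -1:] i * coeff [:1, -1:] (i + 1) * fps_nth (Phi [:1, -1:]) (2 * (2 * k + i) + 1) *
    fps_nth (Phi [:1, -1:]) (2 * (2 * k + i) + 2) = -1"
    unfolding c_def[symmetric] \<open>i = 0\<close> by simp
qed (auto simp: coeff_pCons split: nat.splits)

text \<open>
  A form of \<open>apwenian_Phi_oddI\<close> whose hypotheses can be verified by symbolic evaluation.
\<close>

lemma apwenian_Phi_PolyI:
  assumes "odd (length vs)" "length vs \<ge> 2" "vs ! 0 = 1" "set vs \<subseteq> {1, -1}"
  assumes crit: "\<forall>i\<in>set [0..<length vs - 1].
    vs ! i * vs ! (i + 1) * vs ! ((2 * i + 1) mod length vs) * vs ! ((2 * i + 2) mod length vs) = -1"
  shows "apwenian (Phi (Poly vs))"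
proof (rule apwenian_Phi_oddI[OF _ assms(1,2)])
  have "last vs \<in> set vs"
    using assms(2) by (intro last_in_set) auto
  then have "last vs \<noteq> 0"
    using assms(4) by auto
  then have "coeffs (Poly vs) = vs"
    by (simp add: no_trailing_unfold)
  then show "length vs = Suc (degree (Poly vs))"
    using assms(2) by (subst degree_eq_length_coeffs) auto
  have coeff: "coeff (Poly vs) i = vs ! i" if "i < length vs" for i
    using that by (simp add: nth_default_def)
  show "coeff (Poly vs) i \<in> {1, -1}" if "i < length vs" for i
    using assms(4) nth_mem[OF that] unfolding coeff[OF that] by blast
  have "length vs > 0" using assms(2) by linarith
  then show "coeff (Poly vs) 0 = 1"
    by (simp only: coeff assms(3))
  show "coeff (Poly vs) i * coeff (Poly vs) (i + 1) * coeff (Poly vs) ((2 * i + 1) mod length vs) *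
      coeff (Poly vs) ((2 * i + 2) mod length vs) = -1" if "i < length vs - 1" for i
    using that crit \<open>length vs > 0\<close> by (subst (1 2 3 4) coeff) auto
qed

section \<open>The seven series\<close>

theorem theorem1p2:
  shows "apwenian (Phi [:1, -1:]) \<and>
         apwenian (Phi [:1, -1, -1:]) \<and>
         apwenian (Phi [:1, -1, -1, -1, 1:]) \<and>
         apwenian (Phi [:1, -1, -1, 1, -1, 1, 1, 1, 1, -1, -1:]) \<and>
         apwenian (Phi [:1, -1, -1, 1, -1, -1, -1, -1, -1, 1, -1, -1, 1:]) \<and>
         apwenian (Phi [:1, -1, -1, 1, -1, 1, 1, 1, 1, 1, 1, 1, -1, 1, -1, -1, 1:]) \<and>
         apwenian (Phi [:1, -1, -1, -1, 1, 1, -1, 1, 1, 1, -1, 1, 1, -1, -1, -1, 1:])"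
proof (intro conjI)
  show "apwenian (Phi [:1, -1:])"
    by (rule apwenian_Phi_Thue_Morse)
next
  have "apwenian (Phi (Poly [1, -1, -1]))"
    by (rule apwenian_Phi_PolyI; code_simp)
  then show "apwenian (Phi [:1, -1, -1:])"
    by simp
next
  have "apwenian (Phi (Poly [1, -1, -1, -1, 1]))"
    by (rule apwenian_Phi_PolyI; code_simp)
  then show "apwenian (Phi [:1, -1, -1, -1, 1:])"
    by simp
next
  have "apwenian (Phi (Poly [1, -1, -1, 1, -1, 1, 1, 1, 1, -1, -1]))"
    by (rule apwenian_Phi_PolyI; code_simp)
  then show "apwenian (Phi [:1, -1, -1, 1, -1, 1, 1, 1, 1, -1, -1:])"
    by simp
next
  have "apwenian (Phi (Poly [1, -1, -1, 1, -1, -1, -1, -1, -1, 1, -1, -1, 1]))"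
    by (rule apwenian_Phi_PolyI; code_simp)
  then show "apwenian (Phi [:1, -1, -1, 1, -1, -1, -1, -1, -1, 1, -1, -1, 1:])"
    by simp
next
  have "apwenian (Phi (Poly [1, -1, -1, 1, -1, 1, 1, 1, 1, 1, 1, 1, -1, 1, -1, -1, 1]))"
    by (rule apwenian_Phi_PolyI; code_simp)
  then show "apwenian (Phi [:1, -1, -1, 1, -1, 1, 1, 1, 1, 1, 1, 1, -1, 1, -1, -1, 1:])"
    by simp
next
  have "apwenian (Phi (Poly [1, -1, -1, -1, 1, 1, -1, 1, 1, 1, -1, 1, 1, -1, -1, -1, 1]))"
    by (rule apwenian_Phi_PolyI; code_simp)
  then show "apwenian (Phi [:1, -1, -1, -1, 1, 1, -1, 1, 1, 1, -1, 1, 1, -1, -1, -1, 1:])"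
    by simp
qed

end
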